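(* Let $f(X)=a_nX^n+\cdots+a_1X+a_0$ be a polynomial with real coefficients, with $n\ge 1$ and $a_n>0$. Denote by $j_1<j_2<\cdots<j_\ell$ the indices $j$ for which $a_j<0$, and by $k_1<k_2<\cdots<k_t=n$ the indices $k>j_\ell$ for which $a_k>0$. Let $$v=\min_{1\le r\le t}\ \max_{1\le i\le \ell}\left(\frac{|a_{j_1}+a_{j_2}+\cdots+a_{j_\ell}|}{a_{k_r}}\right)^{\frac{1}{k_r-j_i}}.$$ Then $f$ has no zero in the sector $S_{v,\frac{\pi}{n}}$.
   Context: For real numbers $v,\theta$ with $0<\theta\le\pi$, define the open sector $S_{v,\theta}=\{z=v+\rho e^{i\varphi}\in\mathbb{C}:\rho>0,\ |\varphi|<\theta\}$ (with $\varphi$ real). If $f$ has no negative coefficients ($\ell=0$), the condition $k>j_\ell$ is void and the maximum over the empty set is understood to be $0$, i.e. $v=0$. *)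

theory Defs
  imports Complex_Main "HOL-Computational_Algebra.Polynomial"
begin

definition sector :: "real \<Rightarrow> real \<Rightarrow> complex set" where
  "sector v \<theta> =
     {of_real v + of_real \<rho> * exp (\<i> * of_real \<phi>) | \<rho> \<phi> :: real. \<rho> > 0 \<and> \<bar>\<phi>\<bar> < \<theta>}"

definition neg_indices :: "real poly \<Rightarrow> nat set" where
  "neg_indices f = {j. coeff f j < 0}"

text \<open>If there is no negative coefficient, the condition that \<open>k\<close> exceeds the largest index of a
  negative coefficient is void; hence the bounded quantifier instead of \<open>Max (neg_indices f) < k\<close>.\<close>

definition top_pos_indices :: "real poly \<Rightarrow> nat set" where
  "top_pos_indices f = {k. coeff f k > 0 \<and> (\<forall>j\<in>neg_indices f. j < k)}"

text \<open>Maximum of a finite set, with the convention that the maximum of the empty set is 0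
  (\<open>Max {}\<close> is unspecified in the library).\<close>

definition max_or_zero :: "real set \<Rightarrow> real" where
  "max_or_zero A = (if A = {} then 0 else Max A)"

text \<open>The base of the power is positive whenever the inner maximum ranges over a nonempty set,
  so \<open>powr\<close> is the ordinary real root there.\<close>

definition sector_vertex :: "real poly \<Rightarrow> real" where
  "sector_vertex f =
     (MIN k\<in>top_pos_indices f.
        max_or_zero
          ((\<lambda>j. (\<bar>\<Sum>i\<in>neg_indices f. coeff f i\<bar> / coeff f k) powr (1 / (real k - real j)))
             ` neg_indices f))"

end

theory Submission
  imports Defs
begin

text \<open>Write \<open>v\<close> for the vertex, attained at the index \<open>k\<close>. By the choice of \<open>v\<close>, the term
  \<open>a\<^sub>k X\<^sup>k\<close> absorbs all negative terms of \<open>f\<close> at \<open>v\<close>. Since binomial coefficients \<open>j choose m\<close> increase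
  with \<open>j\<close>, the same happens for every derivative, so the Taylor expansion of \<open>f\<close> at \<open>v\<close> has
  nonnegative coefficients and leading coefficient \<open>a\<^sub>n > 0\<close>. Such an expansion does not vanish at
  \<open>\<rho> exp (\<i> \<phi>)\<close> with \<open>0 < \<phi> < \<pi> / n\<close>, because all the sines \<open>sin (m \<phi>)\<close> with \<open>m \<le> n\<close> are
  nonnegative and \<open>sin (n \<phi>) > 0\<close>.\<close>

lemma nonneg_coeffs_no_zero_in_sector:
  fixes c :: "nat \<Rightarrow> real"
  assumes c_nonneg: "\<And>m. m \<le> n \<Longrightarrow> c m \<ge> 0" and c_pos: "c n > 0" and n: "n > 0"
    and \<rho>: "\<rho> > 0" and \<phi>: "\<bar>\<phi>\<bar> < pi / real n"
  shows "(\<Sum>m\<le>n. of_real (c m) * (of_real \<rho> * exp (\<i> * of_real \<phi>)) ^ m) \<noteq> (0 :: complex)"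
    (is "?S \<noteq> 0")
proof -
  have term_eq: "of_real (c m) * (of_real \<rho> * exp (\<i> * of_real \<phi>)) ^ m
      = of_real (c m * \<rho> ^ m) * cis (real m * \<phi>)" for m
    by (simp add: power_mult_distrib DeMoivre flip: cis_conv_exp)
  show ?thesis
  proof (cases "\<phi> = 0")
    case True
    \<comment> \<open>At angle 0 all the sines vanish, so the real part has to witness that the sum
      is nonzero.\<close>
    have "0 < c n * \<rho> ^ n"
      using c_pos \<rho> by simp
    also have "\<dots> \<le> (\<Sum>m\<le>n. c m * \<rho> ^ m)"
      using c_nonneg \<rho> by (intro member_le_sum) auto
    also have "\<dots> = Re ?S"
      unfolding term_eq using True by simp
    finally show ?thesis
      by (metis order_less_irrefl zero_complex.sel(1))
  next
    case False
    \<comment> \<open>The coefficients are real, so passing from \<open>\<phi>\<close> to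
      \<open>\<bar>\<phi>\<bar>\<close> only multiplies the imaginary part by
      \<open>sgn \<phi>\<close>; this covers both halves of the sector at once.\<close>
    define \<psi> where "\<psi> = \<bar>\<phi>\<bar>"
    have n\<psi>: "real n * \<psi> < pi" and \<psi>: "\<psi> > 0"
      using \<phi> n False by (auto simp: \<psi>_def field_simps)
    have sin_nonneg: "sin (real m * \<psi>) \<ge> 0" if "m \<le> n" for m
    proof (rule sin_ge_zero)
      have "real m * \<psi> \<le> real n * \<psi>"
        using that \<psi> by (intro mult_right_mono) auto
      then show "real m * \<psi> \<le> pi"
        using n\<psi> by linarith
    qed (use \<psi> in simp)
    have "0 < c n * \<rho> ^ n * sin (real n * \<psi>)"
      using c_pos \<rho> n n\<psi> \<psi> by (intro mult_pos_pos sin_gt_zero) auto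
    also have "\<dots> \<le> (\<Sum>m\<le>n. c m * \<rho> ^ m * sin (real m * \<psi>))"
      using c_nonneg \<rho> sin_nonneg
      by (intro member_le_sum[where f = "\<lambda>m. c m * \<rho> ^ m * sin (real m * \<psi>)"]) auto
    also have "\<dots> = sgn \<phi> * Im ?S"
      unfolding term_eq using False
      by (auto simp: \<psi>_def abs_if sgn_if sum_negf)
    finally show ?thesis
      by (metis mult_zero_right order_less_irrefl zero_complex.sel(2))
  qed
qed

lemma poly_complex_taylor:
  fixes f :: "real poly" and v :: real and w :: complex
  shows "poly (map_poly complex_of_real f) (of_real v + w)
    = (\<Sum>m\<le>degree f.
        of_real (\<Sum>k\<le>degree f. coeff f k * of_nat (k choose m) * v ^ (k - m)) * w ^ m)"
proof -
  let ?n = "degree f"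
  have "poly (map_poly complex_of_real f) (of_real v + w)
      = (\<Sum>k\<le>?n. of_real (coeff f k) * (w + of_real v) ^ k)"
    by (simp add: poly_altdef coeff_map_poly degree_map_poly add.commute)
  also have "\<dots> = (\<Sum>k\<le>?n. \<Sum>m\<le>?n.
      of_real (coeff f k * of_nat (k choose m) * v ^ (k - m)) * w ^ m)"
  proof (rule sum.cong[OF refl])
    fix k assume "k \<in> {..?n}"
    \<comment> \<open>Padding the inner sum with zero terms gives it a range independent of
      \<open>k\<close>, so that the two sums can be exchanged.\<close>
    then have "(\<Sum>m\<le>k. of_nat (k choose m) * w ^ m * of_real v ^ (k - m))
        = (\<Sum>m\<le>?n. of_nat (k choose m) * w ^ m * of_real v ^ (k - m))"
      by (intro sum.mono_neutral_left) (auto simp: binomial_eq_0)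
    then show "of_real (coeff f k) * (w + of_real v) ^ k
        = (\<Sum>m\<le>?n. of_real (coeff f k * of_nat (k choose m) * v ^ (k - m)) * w ^ m)"
      by (simp add: binomial_ring sum_distrib_left mult_ac)
  qed
  also have "\<dots> = (\<Sum>m\<le>?n. of_real (\<Sum>k\<le>?n. coeff f k * of_nat (k choose m) * v ^ (k - m)) * w ^ m)"
    by (subst sum.swap) (simp add: sum_distrib_right)
  finally show ?thesis .
qed

lemma finite_neg_indices: "finite (neg_indices f)"
  by (rule finite_subset[of _ "{..degree f}"]) (auto simp: neg_indices_def intro: le_degree)

lemma finite_top_pos_indices: "finite (top_pos_indices f)"
  by (rule finite_subset[of _ "{..degree f}"]) (auto simp: top_pos_indices_def intro: le_degree)

lemma degree_in_top_pos_indices: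
  assumes "lead_coeff f > 0"
  shows "degree f \<in> top_pos_indices f"
  using assms le_degree[of f]
  by (force simp: top_pos_indices_def neg_indices_def order_less_le)

text \<open>The index \<open>k\<close> is one at which the minimum is attained. The vertex is then
  at least each of the roots belonging to \<open>k\<close>, and raising this to the power
  \<open>k - j\<close> clears the root.\<close>

lemma sector_vertex_bound:
  assumes "lead_coeff f > 0"
  obtains k where "k \<in> top_pos_indices f" "sector_vertex f \<ge> 0"
    "\<And>j. j \<in> neg_indices f \<Longrightarrow> sector_vertex f > 0"
    "\<And>j. j \<in> neg_indices f \<Longrightarrow>
      \<bar>\<Sum>i\<in>neg_indices f. coeff f i\<bar> \<le> coeff f k * sector_vertex f ^ (k - j)"
proof -
  let ?N = "neg_indices f"
  define s where "s = \<bar>\<Sum>i\<in>?N. coeff f i\<bar>"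
  define A where "A k = (\<lambda>j. (s / coeff f k) powr (1 / (real k - real j))) ` ?N" for k
  have "sector_vertex f = (MIN k\<in>top_pos_indices f. max_or_zero (A k))"
    by (simp add: sector_vertex_def A_def s_def)
  also have "\<dots> \<in> (\<lambda>k. max_or_zero (A k)) ` top_pos_indices f"
    using degree_in_top_pos_indices[OF assms] finite_top_pos_indices by (intro Min_in) auto
  finally obtain k where k: "k \<in> top_pos_indices f" and v: "sector_vertex f = max_or_zero (A k)"
    by auto
  have ak: "coeff f k > 0"
    using k by (simp add: top_pos_indices_def)
  have bound: "sector_vertex f > 0 \<and> s \<le> coeff f k * sector_vertex f ^ (k - j)" if j: "j \<in> ?N" for j
  proof -
    have jk: "j < k"
      using k j by (simp add: top_pos_indices_def)
    \<comment> \<open>A single negative coefficient makes the base of \<open>powr\<close> positive,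
      so that the power \<open>k - j\<close> inverts the root.\<close>
    have "0 < (\<Sum>i\<in>?N. - coeff f i)"
      using j finite_neg_indices by (intro sum_pos) (auto simp: neg_indices_def)
    then have r: "s / coeff f k > 0"
      using ak by (simp add: s_def sum_negf divide_neg_pos)
    have le: "(s / coeff f k) powr (1 / (real k - real j)) \<le> sector_vertex f"
      using j finite_neg_indices unfolding v max_or_zero_def A_def by auto
    have pos: "(s / coeff f k) powr (1 / (real k - real j)) > 0"
      using r by (subst powr_gt_zero) auto
    have "s / coeff f k = ((s / coeff f k) powr (1 / (real k - real j))) ^ (k - j)"
      unfolding powr_realpow[OF pos, symmetric] powr_powr
      using abs_of_pos[OF r] jk by (simp add: of_nat_diff)
    also have "\<dots> \<le> sector_vertex f ^ (k - j)"
      using le pos by (intro power_mono) auto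
    finally show ?thesis
      using ak order_less_le_trans[OF pos le] by (simp add: field_simps)
  qed
  have "sector_vertex f \<ge> 0"
  proof (cases "?N = {}")
    case True
    \<comment> \<open>Here the convention for the empty maximum enters: the vertex is 0.\<close>
    then show ?thesis
      by (simp add: v max_or_zero_def A_def)
  next
    case False
    then show ?thesis
      using bound by (force intro: less_imp_le)
  qed
  then show ?thesis
    using that k bound unfolding s_def by blast
qed

text \<open>The contribution \<open>t k\<close> of one positive coefficient outweighs those of all
  negative ones together: each negative index \<open>j\<close> is charged to the share
  \<open>- coeff f j / s\<close> of \<open>t k\<close>, and these shares add up to 1.\<close>

lemma taylor_coeff_at_sector_vertex_nonneg:
  assumes "lead_coeff f > 0"
  shows "(\<Sum>k\<le>degree f. coeff f k * of_nat (k choose m) * sector_vertex f ^ (k - m)) \<ge> 0"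
proof -
  let ?N = "neg_indices f"
  define v where "v = sector_vertex f"
  define s where "s = (\<Sum>j\<in>?N. - coeff f j)"
  define t where "t = (\<lambda>k. coeff f k * of_nat (k choose m) * v ^ (k - m))"
  obtain k where k: "k \<in> top_pos_indices f" and v_nonneg: "v \<ge> 0"
    and v_pos: "\<And>j. j \<in> ?N \<Longrightarrow> v > 0"
    and bound: "\<And>j. j \<in> ?N \<Longrightarrow> s \<le> coeff f k * v ^ (k - j)"
    using sector_vertex_bound[OF assms]
    by (metis abs_minus_cancel abs_ge_self order_trans s_def sum_negf v_def)
  have ak: "coeff f k > 0" and kN: "k \<notin> ?N"
    using k by (auto simp: top_pos_indices_def neg_indices_def)
  have s_nonneg: "s \<ge> 0"
    unfolding s_def by (intro sum_nonneg) (auto simp: neg_indices_def)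
  have neg_terms: "- coeff f j * t k \<ge> s * - t j" if j: "j \<in> ?N" for j
  proof (cases "m \<le> j")
    \<comment> \<open>For \<open>m > j\<close> the contribution of \<open>j\<close> vanishes, and
      \<open>t k\<close> is nonnegative.\<close>
    case False
    then show ?thesis
      using j ak v_nonneg
      by (auto simp: t_def neg_indices_def binomial_eq_0 mult_nonpos_nonneg)
  next
    case True
    have jk: "j < k"
      using k j by (simp add: top_pos_indices_def)
    have a: "- coeff f j \<ge> 0"
      using j by (simp add: neg_indices_def)
    \<comment> \<open>The bound at \<open>j\<close> is multiplied by \<open>v ^ (j - m)\<close>, and
      \<open>j choose m\<close> is enlarged to \<open>k choose m\<close>; the exponents add up to
      \<open>k - m\<close>.\<close>
    have "s * (of_nat (j choose m) * v ^ (j - m))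
        \<le> coeff f k * v ^ (k - j) * (of_nat (k choose m) * v ^ (j - m))"
      using bound[OF j] v_nonneg jk ak binomial_right_mono[of j k m]
      by (intro mult_mono) (auto intro!: mult_right_mono)
    also have "\<dots> = t k"
      using True jk by (simp add: t_def mult_ac flip: power_add)
    finally have "- coeff f j * (s * (of_nat (j choose m) * v ^ (j - m))) \<le> - coeff f j * t k"
      using a by (rule mult_left_mono)
    then show ?thesis
      by (simp add: t_def mult_ac)
  qed
  have "s * (\<Sum>j\<in>?N. - t j) \<le> s * t k"
  proof -
    have "s * (\<Sum>j\<in>?N. - t j) \<le> (\<Sum>j\<in>?N. - coeff f j * t k)"
      unfolding sum_distrib_left using neg_terms by (intro sum_mono) auto
    then show ?thesis
      by (simp add: s_def sum_distrib_right)
  qed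
  \<comment> \<open>The factor \<open>s\<close> cancels only if it is positive, that is, if some
    coefficient is negative.\<close>
  then have absorb: "(\<Sum>j\<in>?N. - t j) \<le> t k"
  proof (cases "?N = {}")
    case True
    then show ?thesis
      using ak v_nonneg by (simp add: t_def)
  next
    case False
    then have "s > 0"
      unfolding s_def using finite_neg_indices by (intro sum_pos) (auto simp: neg_indices_def)
    then show ?thesis
      using \<open>s * (\<Sum>j\<in>?N. - t j) \<le> s * t k\<close> by simp
  qed
  have k_le: "k \<le> degree f" and N_le: "?N \<subseteq> {..degree f}"
    using ak by (auto simp: neg_indices_def intro: le_degree)
  have "0 \<le> (\<Sum>j\<in>insert k ?N. t j)"
    using absorb kN finite_neg_indices by (simp add: sum_negf)
  also have "\<dots> \<le> (\<Sum>j\<le>degree f. t j)"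
    using k_le N_le v_nonneg by (intro sum_mono2) (auto simp: t_def neg_indices_def)
  finally show ?thesis
    by (simp add: t_def v_def)
qed

theorem theorem2p8:
  fixes f :: "real poly" and n :: nat
  assumes "degree f = n" and "n \<ge> 1" and "coeff f n > 0"
  shows "\<not> (\<exists>z \<in> sector (sector_vertex f) (pi / real n). poly (map_poly complex_of_real f) z = 0)"
proof -
  let ?c = "\<lambda>m. \<Sum>k\<le>n. coeff f k * of_nat (k choose m) * sector_vertex f ^ (k - m)"
  \<comment> \<open>The top Taylor coefficient is the leading coefficient of \<open>f\<close>, as
    \<open>k choose n\<close> is 0 for \<open>k < n\<close>.\<close>
  have "?c n = (\<Sum>k\<in>{n}. coeff f k * of_nat (k choose n) * sector_vertex f ^ (k - n))"
    by (intro sum.mono_neutral_right) (auto simp: binomial_eq_0)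
  then have "?c n > 0"
    using assms by simp
  moreover have "?c m \<ge> 0" for m
    using taylor_coeff_at_sector_vertex_nonneg[of f m] assms by simp
  ultimately have "poly (map_poly complex_of_real f)
      (of_real (sector_vertex f) + of_real \<rho> * exp (\<i> * of_real \<phi>)) \<noteq> 0"
    if "\<rho> > 0" "\<bar>\<phi>\<bar> < pi / real n" for \<rho> \<phi>
    unfolding poly_complex_taylor assms(1)
    using that assms(2) by (intro nonneg_coeffs_no_zero_in_sector) auto
  then show ?thesis
    by (auto simp: sector_def)
qed

end
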